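(* Let $n\ge1$, $0\le k\le n$, and consider a stabilizer code on $n$ qubits with $n-k$ independent, mutually commuting stabilizer generators $g_1,\dots,g_{n-k}$, each a Pauli string, with holomorphic representations $\hat g_1,\dots,\hat g_{n-k}$ acting on the physical subspace $\mathcal{H}_{\mathrm{phys}}\subset\mathcal{H}_{\mathrm{SB}}$. For $\mathbf{s}=(s_1,\dots,s_{n-k})\in\{+1,-1\}^{n-k}$ define on $\mathcal{H}_{\mathrm{phys}}$ $$\hat\Pi_{\mathbf{s}}=\prod_{m=1}^{n-k}\frac{\mathbb{I}+s_m\hat g_m}{2}.$$ Then, as operators on $\mathcal{H}_{\mathrm{phys}}$, $$\sum_{\mathbf{s}\in\{\pm1\}^{n-k}}\hat\Pi_{\mathbf{s}}=\mathbb{I},\qquad \hat\Pi_{\mathbf{s}}\hat\Pi_{\mathbf{s}'}=\delta_{\mathbf{s}\mathbf{s}'}\hat\Pi_{\mathbf{s}}\quad\text{for all }\mathbf{s},\mathbf{s}',$$ and for every $f\in\mathcal{H}_{\mathrm{phys}}$, $$\hat\Pi_{(+1,\dots,+1)}f=f\iff f\in\mathcal{C}_{\mathrm{SB}},$$ where $\mathcal{C}_{\mathrm{SB}}=\{f\in\mathcal{H}_{\mathrm{phys}}:\hat g_mf=f,\ m=1,\dots,n-k\}$ is the code space.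
   Context: Segal--Bargmann space: $\mathcal{H}_{\mathrm{SB}}$ is the Hilbert space of holomorphic functions $f:\mathbb{C}^{2n}\to\mathbb{C}$ of the variables $\mathbf{z}=(z_{a_1},z_{b_1},\dots,z_{a_n},z_{b_n})$ that are square-integrable with respect to $d\mu(\mathbf{z})=e^{-\|\mathbf{z}\|^2}\prod_{j=1}^n \frac{d^2z_{a_j}\,d^2z_{b_j}}{\pi^2}$. Physical subspace: $\mathcal{H}_{\mathrm{phys}}$ is the set of $f\in\mathcal{H}_{\mathrm{SB}}$ with $\left(z_{a_j}\partial_{z_{a_j}}+z_{b_j}\partial_{z_{b_j}}\right)f=f$ for all $j=1,\dots,n$; equivalently $f(\mathbf{z})=\sum_{\mathbf{s}\in\{0,1\}^n}c_{\mathbf{s}}\prod_{j=1}^n z_{a_j}^{1-s_j}z_{b_j}^{s_j}$. It is identified with $(\mathbb{C}^2)^{\otimes n}$ via $|0\rangle_j\mapsto z_{a_j}$, $|1\rangle_j\mapsto z_{b_j}$. Holomorphic Pauli operators: $\hat X_j=z_{a_j}\partial_{z_{b_j}}+z_{b_j}\partial_{z_{a_j}}$, $\hat Y_j=-i(z_{a_j}\partial_{z_{b_j}}-z_{b_j}\partial_{z_{a_j}})$, $\hat Z_j=z_{a_j}\partial_{z_{a_j}}-z_{b_j}\partial_{z_{b_j}}$. For a Pauli string $g=\bigotimes_{j=1}^nP_j$ with $P_j\in\{\mathbb{I},X,Y,Z\}$, $\hat g=\prod_{j:\,P_j\ne\mathbb{I}}\hat P_j$, the product ordered by qubit index. These operators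 preserve $\mathcal{H}_{\mathrm{phys}}$. *)

theory Defs
  imports "HOL-Analysis.Analysis" "HOL-Algebra.Generated_Groups"
begin

text \<open>
  The \<open>n\<close> qubits are the elements of a finite linearly ordered type \<open>'n\<close>, so \<open>n = CARD('n)\<close>, and
  \<open>\<complex>\<^sup>2\<^sup>n\<close> is \<open>complex ^ ('n \<times> bool)\<close>.  The coordinate with index \<open>(j, False)\<close> is \<open>z\<^sub>a\<close> and the one
  with index \<open>(j, True)\<close> is \<open>z\<^sub>b\<close> of qubit \<open>j\<close>, in accordance with \<open>|0\<rangle> \<mapsto> z\<^sub>a\<close>, \<open>|1\<rangle> \<mapsto> z\<^sub>b\<close>.
\<close>

type_synonym 'n modes = "complex ^ ('n \<times> bool)"

abbreviation za :: "'n::finite \<Rightarrow> 'n modes \<Rightarrow> complex" where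
  "za j z \<equiv> z $ (j, False)"

abbreviation zb :: "'n::finite \<Rightarrow> 'n modes \<Rightarrow> complex" where
  "zb j z \<equiv> z $ (j, True)"

definition partial_deriv :: "'i::finite \<Rightarrow> (complex ^ 'i \<Rightarrow> complex) \<Rightarrow> complex ^ 'i \<Rightarrow> complex" where
  "partial_deriv p f z = deriv (\<lambda>w. f (\<chi> q. if q = p then w else z $ q)) (z $ p)"

abbreviation da :: "'n::finite \<Rightarrow> ('n modes \<Rightarrow> complex) \<Rightarrow> 'n modes \<Rightarrow> complex" where
  "da j \<equiv> partial_deriv (j, False)"

abbreviation db :: "'n::finite \<Rightarrow> ('n modes \<Rightarrow> complex) \<Rightarrow> 'n modes \<Rightarrow> complex" where
  "db j \<equiv> partial_deriv (j, True)"

text \<open>Holomorphy in several variables: everywhere Frechet differentiable with complex-linear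
  derivative.\<close>

definition entire_on_Cn :: "(complex ^ 'i::finite \<Rightarrow> complex) \<Rightarrow> bool" where
  "entire_on_Cn f \<longleftrightarrow>
     (\<forall>z. \<exists>D. (f has_derivative D) (at z) \<and> (\<forall>c v. D (c *s v) = c * D v))"

definition sb_measure :: "'n::finite modes measure" where
  "sb_measure =
     density lborel (\<lambda>z. ennreal (exp (- (norm z)\<^sup>2) * (\<Prod>j\<in>(UNIV :: 'n set). 1 / pi\<^sup>2)))"

definition H_SB :: "('n::finite modes \<Rightarrow> complex) set" where
  "H_SB = {f. entire_on_Cn f \<and> integrable sb_measure (\<lambda>z. (norm (f z))\<^sup>2)}"

definition H_phys :: "('n::finite modes \<Rightarrow> complex) set" where
  "H_phys = {f \<in> H_SB. \<forall>j. (\<lambda>z. za j z * da j f z + zb j z * db j f z) = f}"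

datatype pauli = PI | PX | PY | PZ

type_synonym 'n pauli_string = "'n \<Rightarrow> pauli"

fun pauli_op :: "pauli \<Rightarrow> 'n::finite \<Rightarrow> ('n modes \<Rightarrow> complex) \<Rightarrow> 'n modes \<Rightarrow> complex" where
  "pauli_op PI j f = f"
| "pauli_op PX j f = (\<lambda>z. za j z * db j f z + zb j z * da j f z)"
| "pauli_op PY j f = (\<lambda>z. - \<i> * (za j z * db j f z - zb j z * da j f z))"
| "pauli_op PZ j f = (\<lambda>z. za j z * da j f z - zb j z * db j f z)"

text \<open>A product of operators is a composition, the rightmost factor acting first.\<close>

definition op_prod :: "('a \<Rightarrow> 'a) list \<Rightarrow> 'a \<Rightarrow> 'a" where
  "op_prod Ts = foldr (\<circ>) Ts id"

definition hol_rep ::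
  "'n::{finite,linorder} pauli_string \<Rightarrow> ('n modes \<Rightarrow> complex) \<Rightarrow> 'n modes \<Rightarrow> complex" where
  "hol_rep g = op_prod (map (\<lambda>j. pauli_op (g j) j) (sorted_list_of_set {j. g j \<noteq> PI}))"

fun pauli_entry :: "pauli \<Rightarrow> bool \<Rightarrow> bool \<Rightarrow> complex" where
  "pauli_entry PI s t = (if s = t then 1 else 0)"
| "pauli_entry PX s t = (if s = t then 0 else 1)"
| "pauli_entry PY s t = (if s = t then 0 else if s then \<i> else - \<i>)"
| "pauli_entry PZ s t = (if s = t then (if s then - 1 else 1) else 0)"

text \<open>The tensor product of the Pauli matrices of \<open>g\<close>, in the computational basis of
  \<open>(\<complex>\<^sup>2)\<^sup>\<otimes>\<^sup>n\<close>, whose vectors are indexed by bit strings \<open>'n \<Rightarrow> bool\<close>.\<close>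

definition pauli_matrix :: "'n::finite pauli_string \<Rightarrow> complex ^ ('n \<Rightarrow> bool) ^ ('n \<Rightarrow> bool)" where
  "pauli_matrix g = (\<chi> s t. \<Prod>j\<in>UNIV. pauli_entry (g j) (s j) (t j))"

definition GL :: "(complex ^ 'm ^ 'm::finite) monoid" where
  "GL = \<lparr>carrier = {A. invertible A}, mult = (**), one = mat 1\<rparr>"

text \<open>Independence means that no generator can be dropped without making the generated group
  smaller.  That the group does not contain \<open>-I\<close> is part of the definition of a stabilizer
  group.\<close>

definition stabilizer_generators :: "nat \<Rightarrow> (nat \<Rightarrow> 'n::finite pauli_string) \<Rightarrow> bool" where
  "stabilizer_generators r g \<longleftrightarrow>
     (\<forall>l\<in>{1..r}. \<forall>m\<in>{1..r}.
        pauli_matrix (g l) ** pauli_matrix (g m) = pauli_matrix (g m) ** pauli_matrix (g l)) \<and>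
     (\<forall>m\<in>{1..r}. pauli_matrix (g m) \<notin> generate GL ((\<lambda>l. pauli_matrix (g l)) ` ({1..r} - {m}))) \<and>
     - mat 1 \<notin> generate GL ((\<lambda>l. pauli_matrix (g l)) ` {1..r})"

definition sign_vectors :: "nat \<Rightarrow> (nat \<Rightarrow> complex) set" where
  "sign_vectors r = {1..r} \<rightarrow>\<^sub>E {1, - 1}"

definition syndrome_proj ::
  "nat \<Rightarrow> (nat \<Rightarrow> 'n::{finite,linorder} pauli_string) \<Rightarrow> (nat \<Rightarrow> complex)
     \<Rightarrow> ('n modes \<Rightarrow> complex) \<Rightarrow> 'n modes \<Rightarrow> complex" where
  "syndrome_proj r g s =
     op_prod (map (\<lambda>m f z. (f z + s m * hol_rep (g m) f z) / 2) [1..<Suc r])"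

definition code_space ::
  "nat \<Rightarrow> (nat \<Rightarrow> 'n::{finite,linorder} pauli_string) \<Rightarrow> ('n modes \<Rightarrow> complex) set" where
  "code_space r g = {f \<in> H_phys. \<forall>m\<in>{1..r}. hol_rep (g m) f = f}"

end

theory Submission imports Defs begin

text \<open>Every \<open>f \<in> H_phys\<close> is \<open>\<Sum>\<^sub>s c\<^sub>s \<Prod>\<^sub>j z\<^bsub>j,s\<^sub>j\<^esub>\<close> for some coefficient vector \<open>c\<close>, and on such functions
  \<open>hol_rep g\<close> acts on \<open>c\<close> as the Pauli matrix of \<open>g\<close>.  The claims thus reduce to the factors
  \<open>(I + s\<^sub>m A\<^sub>m) / 2\<close> of commuting involutory matrices \<open>A\<^sub>m\<close>.  Only the existence of \<open>c\<close> is
  used, not its uniqueness, and the projected functions need not be shown to be in \<open>H_phys\<close>.\<close>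

text \<open>The function that the identification |0> -> z_a, |1> -> z_b assigns to the n-qubit
  vector with coefficients \<open>c\<close>.\<close>

definition tensor_fun :: "complex ^ ('n::finite \<Rightarrow> bool) \<Rightarrow> 'n modes \<Rightarrow> complex" where
  "tensor_fun c z = (\<Sum>s\<in>UNIV. c $ s * (\<Prod>j\<in>UNIV. z $ (j, s j)))"

lemma tensor_fun_add: "tensor_fun (c + d) z = tensor_fun c z + tensor_fun d z"
  by (simp add: tensor_fun_def sum.distrib algebra_simps)

lemma tensor_fun_scale: "tensor_fun (a *s c) z = a * tensor_fun c z"
  by (simp add: tensor_fun_def sum_distrib_left mult.assoc)

lemma tensor_fun_0: "tensor_fun 0 = (\<lambda>z. 0)"
  by (simp add: tensor_fun_def fun_eq_iff)

lemma tensor_fun_sum: "tensor_fun (\<Sum>x\<in>A. h x) z = (\<Sum>x\<in>A. tensor_fun (h x) z)"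
  by (induction A rule: infinite_finite_induct) (simp_all add: tensor_fun_add tensor_fun_0)

section \<open>The physical subspace consists of multilinear functions\<close>

text \<open>Chain rule along the complex line through \<open>z\<close> in direction
  \<open>axis p 1\<close>. Complex linearity turns the real derivative
  \<open>h -> D (h *s axis p 1)\<close> into multiplication by \<open>D (axis p 1)\<close>.\<close>

lemma has_derivative_partial_deriv:
  fixes f :: "complex ^ 'i::finite \<Rightarrow> complex"
  assumes D: "(f has_derivative D) (at z)" and lin: "\<And>c v. D (c *s v) = c * D v"
  shows "partial_deriv p f z = D (axis p 1)"
proof -
  have upd: "(\<chi> q. if q = p then w else z $ q) = z + (w - z $ p) *s axis p 1" for w
    by (simp add: vec_eq_iff axis_def)
  have "bounded_linear (\<lambda>h. h *s axis p (1 :: complex))"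
    by (intro linear_conv_bounded_linear[THEN iffD1] linearI)
       (auto simp: vec_eq_iff axis_def algebra_simps)
  then have "((\<lambda>h. h *s axis p 1) has_derivative (\<lambda>h. h *s axis p (1 :: complex))) F" for F
    by (rule bounded_linear_imp_has_derivative)
  then have "((\<lambda>w. z + (w - z $ p) *s axis p 1) has_derivative (\<lambda>h. h *s axis p 1)) (at (z $ p))"
    by (auto simp: vector_sub_rdistrib intro!: derivative_eq_intros)
  then have "((\<lambda>w. f (z + (w - z $ p) *s axis p 1)) has_derivative (\<lambda>h. D (h *s axis p 1))) (at (z $ p))"
    by (rule has_derivative_compose[where g = f]) (simp add: D)
  then have "((\<lambda>w. f (z + (w - z $ p) *s axis p 1)) has_field_derivative D (axis p 1)) (at (z $ p))"
    unfolding has_field_derivative_def by (simp only: lin mult.commute[of _ "D (axis p 1)"])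
  then show ?thesis
    unfolding partial_deriv_def upd by (rule DERIV_imp_deriv)
qed

text \<open>Written with axis vectors so that a complex-linear derivative applied to it splits into
  the two terms of the Euler operator of qubit \<open>j\<close>.\<close>

definition pair_part :: "'n::finite \<Rightarrow> 'n modes \<Rightarrow> 'n modes" where
  "pair_part j z = za j z *s axis (j, False) 1 + zb j z *s axis (j, True) 1"

lemma pair_part_nth: "pair_part j z $ q = (if fst q = j then z $ q else 0)"
  by (cases q) (auto simp: pair_part_def axis_def)

text \<open>Along the ray \<open>t \<mapsto> z\<^sub>0 + t v\<close>, with \<open>v\<close> the \<open>j\<close>-th pair of \<open>z\<close> and \<open>z\<^sub>0 = z - v\<close>, Euler's
  equation reads \<open>t \<phi>' = \<phi>\<close>.  Hence \<open>\<phi>(t) = t \<phi>(1)\<close> for \<open>t > 0\<close>, and \<open>\<phi>(1)\<close> is the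
  derivative at the origin of the ray, which is linear in \<open>v\<close>.\<close>

lemma H_phys_eq_derivative:
  fixes f :: "'n::finite modes \<Rightarrow> complex"
  assumes f: "f \<in> H_phys"
    and D: "(f has_derivative D) (at (z - pair_part j z))"
  shows "f z = D (pair_part j z)"
proof -
  define v where "v = pair_part j z"
  define \<phi> where "\<phi> t = f (z - v + t *\<^sub>R v)" for t :: real
  \<comment> \<open>Euler's equation is used all along the ray, so a derivative is chosen at every
    point; \<open>D\<close> is matched with \<open>D'\<close> only at the end, by
    uniqueness.\<close>
  have "\<exists>D'. \<forall>z. (f has_derivative D' z) (at z) \<and> (\<forall>c v. D' z (c *s v) = c * D' z v)"
    using f by (intro choice) (auto simp: H_phys_def H_SB_def entire_on_Cn_def)
  then obtain D' where D': "\<And>z. (f has_derivative D' z) (at z)"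
    and lin: "\<And>z c v. D' z (c *s v) = c * D' z v"
    by blast
  have add: "D' z (x + y) = D' z x + D' z y" for z x y
    using D' has_derivative_bounded_linear linear_add bounded_linear.linear by metis
  have euler: "D' w (pair_part j w) = f w" for w
  proof -
    have "(\<lambda>z. za j z * da j f z + zb j z * db j f z) = f"
      using f by (simp add: H_phys_def)
    from fun_cong[OF this, of w] show ?thesis
      by (simp add: has_derivative_partial_deriv[OF D' lin] pair_part_def add lin)
  qed
  have deriv: "(\<phi> has_vector_derivative D' (z - v + t *\<^sub>R v) v) (at t)" for t
  proof -
    have "((\<lambda>t. z - v + t *\<^sub>R v) has_derivative (\<lambda>h. h *\<^sub>R v)) (at t)"
      by (auto intro!: derivative_eq_intros)
    from has_derivative_compose[OF this D']
    show ?thesis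
      unfolding \<phi>_def has_vector_derivative_def
      using linear_cmul[OF bounded_linear.linear[OF has_derivative_bounded_linear[OF D']]] by simp
  qed
  have ray: "t *\<^sub>R D' (z - v + t *\<^sub>R v) v = \<phi> t" for t
  proof -
    \<comment> \<open>The base point \<open>z - v\<close> has zero \<open>j\<close>-th pair, so only
      \<open>t v\<close> survives.\<close>
    have "pair_part j (z - v + t *\<^sub>R v) = t *\<^sub>R v"
      by (simp add: vec_eq_iff pair_part_nth v_def)
    with euler[of "z - v + t *\<^sub>R v"] show ?thesis
      unfolding \<phi>_def
      using linear_cmul[OF bounded_linear.linear[OF has_derivative_bounded_linear[OF D']]] by metis
  qed
  \<comment> \<open>By the quotient rule and \<open>ray\<close>, the derivative of \<phi>(t)/t
    vanishes on t > 0.\<close>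
  have const: "\<phi> t /\<^sub>R t = \<phi> 1" if "t > 0" for t
  proof -
    have "\<exists>c. \<forall>x\<in>{0<..}. \<phi> x /\<^sub>R x = c"
    proof (rule has_vector_derivative_zero_constant)
      fix x :: real assume "x \<in> {0<..}"
      then have "x > 0" by simp
      have "((\<lambda>x. \<phi> x /\<^sub>R x) has_vector_derivative
          (inverse x *\<^sub>R D' (z - v + x *\<^sub>R v) v + (- (inverse x * inverse x)) *\<^sub>R \<phi> x)) (at x)"
        using \<open>x > 0\<close> by (auto intro!: derivative_eq_intros deriv simp: field_simps)
      moreover have "inverse x *\<^sub>R D' (z - v + x *\<^sub>R v) v + (- (inverse x * inverse x)) *\<^sub>R \<phi> x = 0"
        using \<open>x > 0\<close> by (simp flip: ray[of x])
      ultimately show "((\<lambda>x. \<phi> x /\<^sub>R x) has_vector_derivative 0) (at x within {0<..})"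
        by (simp add: has_vector_derivative_at_within)
    qed auto
    then obtain c where c: "\<And>x. x > 0 \<Longrightarrow> \<phi> x /\<^sub>R x = c" by auto
    from c[OF that] c[of 1] show ?thesis by simp
  qed
  have "\<phi> 0 = 0" using ray[of 0] by simp
  then have linear: "t *\<^sub>R \<phi> 1 = \<phi> t" if "t \<ge> 0" for t
    using that const[of t] by (cases "t = 0") (auto simp flip: const[of t])
  \<comment> \<open>Linearity of \<phi> is known for t \<ge> 0 only, so the derivatives at 0 are
    compared from the right.\<close>
  have "(\<phi> has_vector_derivative \<phi> 1) (at 0 within {0..})"
    by (rule has_vector_derivative_transform[of _ _ _ "\<lambda>t. t *\<^sub>R \<phi> 1"])
       (auto simp: linear intro!: derivative_eq_intros)
  moreover have "(\<phi> has_vector_derivative D' (z - v) v) (at 0 within {0..})"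
    using deriv[of 0] by (simp add: has_vector_derivative_at_within)
  ultimately have "D' (z - v) v = \<phi> 1"
    by (intro vector_derivative_unique_within) (simp_all add: at_within_Ici_at_right)
  moreover have "D' (z - v) = D"
    using D D' has_derivative_unique unfolding v_def by blast
  ultimately show ?thesis by (simp add: \<phi>_def v_def)
qed

section \<open>Expansion in the coordinates of one qubit, then of all qubits\<close>

definition set_pair :: "'n::finite \<Rightarrow> bool \<Rightarrow> 'n modes \<Rightarrow> 'n modes" where
  "set_pair j b z = (\<chi> q. if fst q = j then of_bool (snd q = b) else z $ q)"

text \<open>Removing the \<open>j\<close>-th pair from \<open>z\<close> or from either
  \<open>set_pair j b z\<close> leaves the same base point, so one complex-linear \<open>D\<close>
  gives the value of \<open>f\<close> at all three points.\<close>

lemma H_phys_expand_pair: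
  fixes f :: "'n::finite modes \<Rightarrow> complex"
  assumes "f \<in> H_phys"
  shows "f z = (\<Sum>b\<in>UNIV. z $ (j, b) * f (set_pair j b z))"
proof -
  define z0 where "z0 = z - pair_part j z"
  obtain D where D: "(f has_derivative D) (at z0)" and lin: "\<And>c v. D (c *s v) = c * D v"
    using assms unfolding H_phys_def H_SB_def entire_on_Cn_def by blast
  have "set_pair j b z - pair_part j (set_pair j b z) = z0" for b
    by (simp add: vec_eq_iff pair_part_nth z0_def set_pair_def)
  then have "f (set_pair j b z) = D (pair_part j (set_pair j b z))" for b
    using H_phys_eq_derivative[OF assms] D by metis
  moreover have "pair_part j (set_pair j b z) = axis (j, b) 1" for b
    by (auto simp: vec_eq_iff pair_part_nth set_pair_def axis_def)
  ultimately have "f (set_pair j b z) = D (axis (j, b) 1)" for b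
    by simp
  moreover have "f z = D (pair_part j z)"
    using H_phys_eq_derivative[OF assms] D by (simp add: z0_def)
  moreover have "D (x + y) = D x + D y" for x y
    using D has_derivative_bounded_linear linear_add bounded_linear.linear by metis
  ultimately show ?thesis
    by (simp add: UNIV_bool pair_part_def lin)
qed

text \<open>Reindexing along the bijection \<open>(b, s) -> s(j := b)\<close>; it serves the
  inductions over bit strings and over sign vectors.\<close>

lemma sum_PiE_insert:
  assumes "j \<notin> J" "finite J" "finite B"
  shows "(\<Sum>s\<in>insert j J \<rightarrow>\<^sub>E B. h s) = (\<Sum>s\<in>J \<rightarrow>\<^sub>E B. \<Sum>b\<in>B. h (s(j := b)))"
proof -
  have "(\<Sum>s\<in>insert j J \<rightarrow>\<^sub>E B. h s) = (\<Sum>(b, s)\<in>B \<times> (J \<rightarrow>\<^sub>E B). h (s(j := b)))"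
    unfolding PiE_insert_eq using assms inj_combinator[of j J "\<lambda>_. B"]
    by (subst sum.reindex) (auto simp: case_prod_unfold)
  also have "\<dots> = (\<Sum>s\<in>J \<rightarrow>\<^sub>E B. \<Sum>b\<in>B. h (s(j := b)))"
    by (subst sum.cartesian_product[symmetric], rule sum.swap)
  finally show ?thesis .
qed

definition set_pairs :: "'n::finite set \<Rightarrow> ('n \<Rightarrow> bool) \<Rightarrow> 'n modes \<Rightarrow> 'n modes" where
  "set_pairs J s z = (\<chi> q. if fst q \<in> J then of_bool (snd q = s (fst q)) else z $ q)"

text \<open>Induction on \<open>J\<close>: each value \<open>f (set_pairs J s z)\<close> is expanded
  in one further pair \<open>i\<close>, which \<open>set_pairs J s\<close> has left
  untouched.\<close>

lemma H_phys_expand_pairs: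
  fixes f :: "'n::finite modes \<Rightarrow> complex"
  assumes "f \<in> H_phys"
  shows "f z = (\<Sum>s\<in>J \<rightarrow>\<^sub>E UNIV. (\<Prod>j\<in>J. z $ (j, s j)) * f (set_pairs J s z))"
proof (induction J rule: finite_induct[OF finite])
  case 1
  show ?case by (simp add: set_pairs_def)
next
  case (2 i J)
  have "(\<Prod>j\<in>J. z $ (j, s j)) * f (set_pairs J s z) =
      (\<Sum>b\<in>UNIV. (\<Prod>j\<in>insert i J. z $ (j, (s(i := b)) j)) * f (set_pairs (insert i J) (s(i := b)) z))"
    for s
  proof -
    have "set_pair i b (set_pairs J s z) = set_pairs (insert i J) (s(i := b)) z" for b
      by (auto simp: vec_eq_iff set_pair_def set_pairs_def)
    moreover have "set_pairs J s z $ (i, b) = z $ (i, b)" for b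
      using 2 by (simp add: set_pairs_def)
    moreover have "(\<Prod>j\<in>J. z $ (j, (s(i := b)) j)) = (\<Prod>j\<in>J. z $ (j, s j))" for b
      using 2 by (intro prod.cong) auto
    ultimately show ?thesis
      using 2 H_phys_expand_pair[OF assms, of "set_pairs J s z" i]
      by (simp add: sum_distrib_left mult_ac)
  qed
  with 2 show ?case by (simp add: sum_PiE_insert)
qed

text \<open>For \<open>J = UNIV\<close> every coordinate has been replaced, so the values of
  \<open>f\<close> in the expansion no longer depend on \<open>z\<close> and become the
  coefficients.\<close>

lemma H_phys_tensor_fun:
  fixes f :: "'n::finite modes \<Rightarrow> complex"
  assumes f: "f \<in> H_phys"
  obtains c where "f = tensor_fun c"
proof
  show "f = tensor_fun (\<chi> s. f (\<chi> q. of_bool (snd q = s (fst q))))"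
  proof
    fix z
    show "f z = tensor_fun (\<chi> s. f (\<chi> q. of_bool (snd q = s (fst q)))) z"
      using H_phys_expand_pairs[OF f, of z UNIV]
      by (simp add: tensor_fun_def set_pairs_def mult.commute)
  qed
qed

section \<open>Holomorphic Pauli strings act as Pauli matrices\<close>

text \<open>The mixed-product rule for tensor products: a product over qubits of sums over bits
  expands into a sum over bit strings.\<close>

lemma pauli_matrix_mult_nth:
  "(pauli_matrix g ** pauli_matrix h) $ s $ t =
     (\<Prod>j\<in>UNIV. \<Sum>b\<in>UNIV. pauli_entry (g j) (s j) b * pauli_entry (h j) b (t j))"
proof -
  have "(\<Prod>j\<in>UNIV. \<Sum>b\<in>UNIV. pauli_entry (g j) (s j) b * pauli_entry (h j) b (t j)) =
      (\<Sum>u\<in>UNIV \<rightarrow>\<^sub>E UNIV. \<Prod>j\<in>UNIV. pauli_entry (g j) (s j) (u j) * pauli_entry (h j) (u j) (t j))"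
    by (rule prod_sum_PiE) auto
  then show ?thesis
    by (simp add: matrix_matrix_mult_def pauli_matrix_def prod.distrib)
qed

lemma pauli_matrix_PI: "pauli_matrix (\<lambda>_. PI) = mat 1"
  by (auto simp: vec_eq_iff pauli_matrix_def mat_def fun_eq_iff)

lemma pauli_matrix_square: "pauli_matrix g ** pauli_matrix g = mat 1"
proof -
  \<comment> \<open>Each of the four single-qubit matrices squares to the identity.\<close>
  have "(\<Sum>b\<in>UNIV. pauli_entry P x b * pauli_entry P b y) = pauli_entry PI x y" for P x y
    by (cases P) (auto simp: UNIV_bool)
  then show ?thesis
    by (simp add: vec_eq_iff pauli_matrix_mult_nth flip: pauli_matrix_PI)
       (simp add: pauli_matrix_def)
qed

lemma pauli_matrix_single_mult:
  assumes "h j = PI"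
  shows "pauli_matrix ((\<lambda>_. PI)(j := P)) ** pauli_matrix h = pauli_matrix (h(j := P))"
proof -
  have *: "(\<Sum>b\<in>UNIV. pauli_entry (((\<lambda>_. PI)(j := P)) i) x b * pauli_entry (h i) b y) =
      pauli_entry ((h(j := P)) i) x y" for i x y
    using assms by (auto simp: UNIV_bool)
  show ?thesis
    unfolding vec_eq_iff pauli_matrix_mult_nth * by (simp add: pauli_matrix_def)
qed

section \<open>Differential operators on multilinear functions\<close>

lemma partial_deriv_tensor_fun:
  "partial_deriv (j, b) (tensor_fun c) z =
     (\<Sum>s\<in>UNIV. c $ s * (if s j = b then \<Prod>i\<in>UNIV - {j}. z $ (i, s i) else 0))"
proof -
  have "(\<Prod>i\<in>UNIV. (\<chi> q. if q = (j, b) then w else z $ q) $ (i, s i)) =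
      (if s j = b then w else z $ (j, s j)) * (\<Prod>i\<in>UNIV - {j}. z $ (i, s i))" for w s
    by (subst prod.remove[of _ j]) (auto intro!: prod.cong arg_cong2[where f = "(*)"])
  then have "tensor_fun c (\<chi> q. if q = (j, b) then w else z $ q) =
      (\<Sum>s\<in>UNIV. c $ s * ((if s j = b then w else z $ (j, s j)) * (\<Prod>i\<in>UNIV - {j}. z $ (i, s i))))" for w
    by (simp add: tensor_fun_def)
  moreover have "((\<lambda>w. \<Sum>s\<in>UNIV. c $ s * ((if s j = b then w else z $ (j, s j)) * (\<Prod>i\<in>UNIV - {j}. z $ (i, s i))))
      has_field_derivative (\<Sum>s\<in>UNIV. c $ s * (if s j = b then \<Prod>i\<in>UNIV - {j}. z $ (i, s i) else 0))) (at w)" for w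
    by (rule DERIV_sum) (auto intro!: derivative_eq_intros)
  ultimately show ?thesis
    unfolding partial_deriv_def by (simp add: DERIV_imp_deriv)
qed

text \<open>The operator acts as the matrix unit |a><b| on qubit \<open>j\<close>: it kills the
  monomials with \<open>s j \<noteq> b\<close> and replaces the bit \<open>b\<close> by
  \<open>a\<close> in the others.\<close>

lemma mult_partial_deriv_tensor_fun:
  "z $ (j, a) * partial_deriv (j, b) (tensor_fun c) z =
     (\<Sum>s\<in>UNIV. c $ s * (of_bool (s j = b) * (\<Prod>i\<in>UNIV. z $ (i, (s(j := a)) i))))"
proof -
  have "(\<Prod>i\<in>UNIV. z $ (i, (s(j := a)) i)) = z $ (j, a) * (\<Prod>i\<in>UNIV - {j}. z $ (i, s i))" for s
    by (subst prod.remove[of _ j]) (auto intro!: prod.cong arg_cong2[where f = "(*)"])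
  then show ?thesis
    by (auto simp: partial_deriv_tensor_fun sum_distrib_left intro!: sum.cong)
qed

lemma sum_pauli_matrix_single:
  "(\<Sum>t\<in>UNIV. pauli_matrix ((\<lambda>_. PI)(j := P)) $ t $ s * h t) =
     (\<Sum>a\<in>UNIV. pauli_entry P a (s j) * h (s(j := a)))"
proof -
  \<comment> \<open>Column \<open>s\<close> is supported on the two bit strings that agree with
    \<open>s\<close> off \<open>j\<close>.\<close>
  have entry: "pauli_matrix ((\<lambda>_. PI)(j := P)) $ t $ s =
      (if t \<in> range (\<lambda>a. s(j := a)) then pauli_entry P (t j) (s j) else 0)" for t
  proof -
    have "t \<in> range (\<lambda>a. s(j := a)) \<longleftrightarrow> (\<forall>i\<in>UNIV - {j}. t i = s i)"
      by (auto simp: fun_eq_iff image_iff)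
    moreover have "(\<Prod>i\<in>UNIV - {j}. pauli_entry (((\<lambda>_. PI)(j := P)) i) (t i) (s i)) =
        (\<Prod>i\<in>UNIV - {j}. of_bool (t i = s i))"
      by (intro prod.cong) auto
    ultimately show ?thesis
      by (auto simp: pauli_matrix_def prod.remove[of UNIV j])
  qed
  have "(\<Sum>t\<in>UNIV. pauli_matrix ((\<lambda>_. PI)(j := P)) $ t $ s * h t) =
      (\<Sum>t\<in>range (\<lambda>a. s(j := a)). pauli_entry P (t j) (s j) * h t)"
    unfolding entry by (intro sum.mono_neutral_cong_right) auto
  also have "\<dots> = (\<Sum>a\<in>UNIV. pauli_entry P a (s j) * h (s(j := a)))"
    by (subst sum.reindex) (auto simp: inj_on_def fun_upd_eqD)
  finally show ?thesis .
qed

lemma pauli_op_tensor_fun: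
  fixes c :: "complex ^ ('n::finite \<Rightarrow> bool)"
  shows "pauli_op P j (tensor_fun c) = tensor_fun (pauli_matrix ((\<lambda>_. PI)(j := P)) *v c)"
proof
  fix z :: "'n modes"
  define m where "m s = (\<Prod>i\<in>UNIV. z $ (i, s i))" for s
  have "tensor_fun (pauli_matrix ((\<lambda>_. PI)(j := P)) *v c) z =
      (\<Sum>t\<in>UNIV. \<Sum>s\<in>UNIV. c $ s * (pauli_matrix ((\<lambda>_. PI)(j := P)) $ t $ s * m t))"
    by (simp add: tensor_fun_def matrix_vector_mult_def m_def sum_distrib_left mult_ac)
  also have "\<dots> = (\<Sum>s\<in>UNIV. c $ s * (\<Sum>a\<in>UNIV. pauli_entry P a (s j) * m (s(j := a))))"
    by (subst sum.swap) (simp add: sum_pauli_matrix_single flip: sum_distrib_left)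
  also have "\<dots> = pauli_op P j (tensor_fun c) z"
  \<comment> \<open>\<open>pauli_op PI\<close> is the identity by definition and not a differential
    operator, so it is treated apart.\<close>
  proof (cases "P = PI")
    case True
    have "(\<Sum>a\<in>UNIV. pauli_entry PI a (s j) * m (s(j := a))) = m s" for s
      by (cases "s j") (auto simp: UNIV_bool fun_upd_idem)
    with True show ?thesis by (simp add: tensor_fun_def m_def)
  next
    case False
    \<comment> \<open>Every other Pauli operator is the combination of the matrix units
      \<open>E a b\<close> with coefficients \<open>pauli_entry P a b\<close>.\<close>
    define E where "E a b = z $ (j, a) * partial_deriv (j, b) (tensor_fun c) z" for a b
    have E: "E a b = (\<Sum>s\<in>UNIV. c $ s * (of_bool (s j = b) * m (s(j := a))))" for a b
      by (simp only: E_def m_def mult_partial_deriv_tensor_fun)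
    have "(\<Sum>s\<in>UNIV. c $ s * (\<Sum>a\<in>UNIV. pauli_entry P a (s j) * m (s(j := a)))) =
        (\<Sum>s\<in>UNIV. \<Sum>a\<in>UNIV. \<Sum>b\<in>UNIV. pauli_entry P a b * (c $ s * (of_bool (s j = b) * m (s(j := a)))))"
    proof (rule sum.cong[OF refl])
      fix s
      show "c $ s * (\<Sum>a\<in>UNIV. pauli_entry P a (s j) * m (s(j := a))) =
        (\<Sum>a\<in>UNIV. \<Sum>b\<in>UNIV. pauli_entry P a b * (c $ s * (of_bool (s j = b) * m (s(j := a)))))"
        by (cases "s j") (simp_all add: UNIV_bool algebra_simps)
    qed
    also have "\<dots> = (\<Sum>a\<in>UNIV. \<Sum>s\<in>UNIV. \<Sum>b\<in>UNIV. pauli_entry P a b * (c $ s * (of_bool (s j = b) * m (s(j := a)))))"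
      by (rule sum.swap)
    also have "\<dots> = (\<Sum>a\<in>UNIV. \<Sum>b\<in>UNIV. pauli_entry P a b * E a b)"
      unfolding E sum_distrib_left by (intro sum.cong refl sum.swap)
    also have "\<dots> = pauli_op P j (tensor_fun c) z"
      using False by (cases P) (simp_all add: UNIV_bool E_def algebra_simps)
    finally show ?thesis .
  qed
  finally show "pauli_op P j (tensor_fun c) z = tensor_fun (pauli_matrix ((\<lambda>_. PI)(j := P)) *v c) z" ..
qed

lemma op_prod_simps: "op_prod [] = id" "op_prod (T # Ts) = T \<circ> op_prod Ts"
  "op_prod (Ts @ [T]) = op_prod Ts \<circ> T"
proof -
  show "op_prod (Ts @ [T]) = op_prod Ts \<circ> T"
    unfolding op_prod_def by (induction Ts) auto
qed (simp_all add: op_prod_def)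

lemma hol_rep_tensor_fun: "hol_rep g (tensor_fun c) = tensor_fun (pauli_matrix g *v c)"
proof -
  \<comment> \<open>Generalised to any list of distinct qubits: distinctness makes the string of the
    tail trivial at the head, so one more factor can be adjoined.\<close>
  have "op_prod (map (\<lambda>j. pauli_op (g j) j) xs) (tensor_fun c) =
      tensor_fun (pauli_matrix (\<lambda>i. if i \<in> set xs then g i else PI) *v c)" if "distinct xs" for xs
    using that
  proof (induction xs)
    case Nil
    then show ?case by (simp add: op_prod_simps pauli_matrix_PI)
  next
    case (Cons j xs)
    have "(\<lambda>i. if i \<in> set xs then g i else PI)(j := g j) =
        (\<lambda>i. if i \<in> set (j # xs) then g i else PI)"
      by auto
    with Cons show ?case
      by (simp add: op_prod_simps pauli_op_tensor_fun matrix_vector_mul_assoc pauli_matrix_single_mult)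
  qed
  moreover have "(\<lambda>i. if g i \<noteq> PI then g i else PI) = g"
    by auto
  ultimately show ?thesis by (simp add: hol_rep_def)
qed

section \<open>Projections of commuting involutions\<close>

text \<open>For an involution \<open>A\<close> and a sign \<open>e\<close>, the projection onto the
  eigenspace of \<open>A\<close> with eigenvalue \<open>e\<close>.\<close>

definition sign_proj :: "complex ^ 'b ^ 'b::finite \<Rightarrow> complex \<Rightarrow> complex ^ 'b \<Rightarrow> complex ^ 'b" where
  "sign_proj A e v = (1 / 2) *s (v + e *s (A *v v))"

definition joint_proj ::
  "nat \<Rightarrow> (nat \<Rightarrow> complex ^ 'b ^ 'b::finite) \<Rightarrow> (nat \<Rightarrow> complex) \<Rightarrow> complex ^ 'b \<Rightarrow> complex ^ 'b" where
  "joint_proj r A s = op_prod (map (\<lambda>m. sign_proj (A m) (s m)) [1..<Suc r])"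

lemma joint_proj_0: "joint_proj 0 A s v = v"
  by (simp add: joint_proj_def op_prod_simps)

lemma joint_proj_Suc: "joint_proj (Suc r) A s v = joint_proj r A s (sign_proj (A (Suc r)) (s (Suc r)) v)"
  by (simp add: joint_proj_def op_prod_simps)

lemma joint_proj_cong:
  assumes "\<And>m. m \<in> {1..r} \<Longrightarrow> s m = s' m"
  shows "joint_proj r A s = joint_proj r A s'"
proof -
  have "map (\<lambda>m. sign_proj (A m) (s m)) [1..<Suc r] = map (\<lambda>m. sign_proj (A m) (s' m)) [1..<Suc r]"
    using assms by (intro map_cong) auto
  then show ?thesis unfolding joint_proj_def by (rule arg_cong)
qed

lemma sign_proj_add: "sign_proj A e (v + w) = sign_proj A e v + sign_proj A e w"
  by (simp add: sign_proj_def matrix_vector_right_distrib vector_add_ldistrib add_ac)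

lemma sign_proj_0: "sign_proj A e 0 = 0"
  by (simp add: sign_proj_def)

lemma joint_proj_add: "joint_proj r A s (v + w) = joint_proj r A s v + joint_proj r A s w"
  by (induction r arbitrary: v w) (simp_all add: joint_proj_0 joint_proj_Suc sign_proj_add)

lemma joint_proj_zero: "joint_proj r A s 0 = 0"
  by (induction r) (simp_all add: joint_proj_0 joint_proj_Suc sign_proj_0)

lemma sign_proj_commute:
  assumes "A ** B = B ** A"
  shows "sign_proj A e (sign_proj B e' v) = sign_proj B e' (sign_proj A e v)"
  using assms
  by (simp add: sign_proj_def matrix_vector_right_distrib vector_scalar_commute vector_add_ldistrib
      matrix_vector_mul_assoc vector_smult_assoc mult_ac add_ac)

text \<open>Since A^2 = I, the product is ((1 + e e') I + (e + e') A) / 4, and both coefficients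
  vanish for opposite signs.\<close>

lemma sign_proj_mult:
  assumes "A ** A = mat 1" "e \<in> {1, - 1}" "e' \<in> {1, - 1}"
  shows "sign_proj A e (sign_proj A e' v) = (if e = e' then sign_proj A e v else 0)"
proof -
  have "A *v (A *v w) = w" for w
    by (simp add: matrix_vector_mul_assoc assms(1))
  then show ?thesis
    using assms(2,3)
    by (auto simp: sign_proj_def matrix_vector_right_distrib vector_scalar_commute vec_eq_iff)
qed

lemma sign_proj_sum: "sign_proj A 1 v + sign_proj A (- 1) v = v"
  by (simp add: sign_proj_def vec_eq_iff)

lemma joint_proj_commute:
  assumes "\<And>m. m \<in> {1..r} \<Longrightarrow> A m ** B = B ** A m"
  shows "joint_proj r A s (sign_proj B e v) = sign_proj B e (joint_proj r A s v)"
  using assms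
proof (induction r arbitrary: v)
  case (Suc r)
  then have "sign_proj (A (Suc r)) (s (Suc r)) (sign_proj B e v) = sign_proj B e (sign_proj (A (Suc r)) (s (Suc r)) v)"
    by (intro sign_proj_commute) auto
  with Suc show ?case by (simp add: joint_proj_Suc)
qed (simp add: joint_proj_0)

lemma joint_proj_mult:
  assumes "\<And>l m. l \<in> {1..r} \<Longrightarrow> m \<in> {1..r} \<Longrightarrow> A l ** A m = A m ** A l"
    and "\<And>m. m \<in> {1..r} \<Longrightarrow> A m ** A m = mat 1"
    and "\<And>m. m \<in> {1..r} \<Longrightarrow> s m \<in> {1, - 1}" "\<And>m. m \<in> {1..r} \<Longrightarrow> s' m \<in> {1, - 1}"
  shows "joint_proj r A s (joint_proj r A s' v) =
    (if \<forall>m\<in>{1..r}. s m = s' m then joint_proj r A s v else 0)"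
  using assms
proof (induction r arbitrary: v)
  case (Suc r)
  \<comment> \<open>Commuting the last factor of the outer product past the inner one brings the two
    factors of \<open>A (Suc r)\<close> together.\<close>
  have "joint_proj r A s' (sign_proj (A (Suc r)) e w) = sign_proj (A (Suc r)) e (joint_proj r A s' w)" for e w
    using Suc.prems(1) by (intro joint_proj_commute) simp
  then have "joint_proj (Suc r) A s (joint_proj (Suc r) A s' v) =
      joint_proj r A s (joint_proj r A s' (sign_proj (A (Suc r)) (s (Suc r)) (sign_proj (A (Suc r)) (s' (Suc r)) v)))"
    by (simp add: joint_proj_Suc)
  also have "\<dots> = joint_proj r A s (joint_proj r A s'
      (if s (Suc r) = s' (Suc r) then sign_proj (A (Suc r)) (s (Suc r)) v else 0))"
    using Suc.prems by (subst sign_proj_mult) auto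
  also have "\<dots> = (if \<forall>m\<in>{1..Suc r}. s m = s' m then joint_proj (Suc r) A s v else 0)"
    using Suc by (auto simp: joint_proj_Suc joint_proj_zero atLeastAtMostSuc_conv)
  finally show ?case .
qed (simp add: joint_proj_0)

text \<open>Summing over the last sign first, the two projections for \<open>A (Suc r)\<close> add
  up to the identity, which leaves the sum for \<open>r\<close>.\<close>

lemma joint_proj_sum: "(\<Sum>s\<in>{1..r} \<rightarrow>\<^sub>E {1, - 1}. joint_proj r A s v) = v"
proof (induction r arbitrary: v)
  case (Suc r)
  have "joint_proj r A (s(Suc r := e)) = joint_proj r A s" for s e
    by (rule joint_proj_cong) auto
  with Suc show ?case
    by (simp add: atLeastAtMostSuc_conv sum_PiE_insert joint_proj_Suc sign_proj_sum flip: joint_proj_add)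
qed (simp add: joint_proj_0)

text \<open>From A^2 = I and s^2 = 1 follows A (I + s A) = s (I + s A). The factor of index
  \<open>m\<close> is moved to the front, where \<open>A m\<close> meets it.\<close>

lemma joint_proj_eigenvector:
  assumes "\<And>l m. l \<in> {1..r} \<Longrightarrow> m \<in> {1..r} \<Longrightarrow> A l ** A m = A m ** A l"
    and "\<And>m. m \<in> {1..r} \<Longrightarrow> A m ** A m = mat 1"
    and "\<And>m. m \<in> {1..r} \<Longrightarrow> s m \<in> {1, - 1}" "m \<in> {1..r}"
  shows "A m *v joint_proj r A s v = s m *s joint_proj r A s v"
  using assms
proof (induction r arbitrary: v)
  case (Suc r)
  show ?case
  proof (cases "m = Suc r")
    case True
    have "A m *v sign_proj (A m) (s m) w = s m *s sign_proj (A m) (s m) w" for w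
    proof -
      have "A m *v (A m *v w) = w"
        using Suc.prems by (simp add: matrix_vector_mul_assoc)
      then show ?thesis
        using Suc.prems(3)[OF Suc.prems(4)]
        by (auto simp: sign_proj_def matrix_vector_right_distrib vector_scalar_commute vec_eq_iff)
    qed
    moreover have "joint_proj r A s (sign_proj (A m) (s m) v) = sign_proj (A m) (s m) (joint_proj r A s v)"
      using Suc.prems(1,4) by (intro joint_proj_commute) simp
    ultimately show ?thesis using True by (simp add: joint_proj_Suc)
  next
    case False
    with Suc show ?thesis by (simp add: joint_proj_Suc)
  qed
qed simp

section \<open>Transfer to the physical subspace\<close>

text \<open>Both products have the same order, so the last factor, which acts first, can be peeled
  off on both sides; \<open>c\<close> varies in the induction.\<close>

lemma syndrome_proj_tensor_fun:
  "syndrome_proj r g s (tensor_fun c) = tensor_fun (joint_proj r (\<lambda>m. pauli_matrix (g m)) s c)"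
proof (induction r arbitrary: c)
  case 0
  show ?case by (simp add: syndrome_proj_def joint_proj_0 op_prod_simps)
next
  case (Suc r)
  have "(\<lambda>z. (tensor_fun c z + s (Suc r) * hol_rep (g (Suc r)) (tensor_fun c) z) / 2) =
      tensor_fun (sign_proj (pauli_matrix (g (Suc r))) (s (Suc r)) c)"
    by (simp add: hol_rep_tensor_fun sign_proj_def tensor_fun_add tensor_fun_scale fun_eq_iff)
  with Suc show ?case by (simp add: syndrome_proj_def joint_proj_Suc op_prod_simps)
qed

text \<open>Each factor maps \<open>f\<close> to (f + f) / 2.\<close>

lemma syndrome_proj_fixed:
  assumes "\<And>m. m \<in> {1..r} \<Longrightarrow> s m = 1" "\<And>m. m \<in> {1..r} \<Longrightarrow> hol_rep (g m) f = f"
  shows "syndrome_proj r g s f = f"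
  using assms
proof (induction r)
  case 0
  show ?case by (simp add: syndrome_proj_def op_prod_simps)
next
  case (Suc r)
  then have "(\<lambda>z. (f z + s (Suc r) * hol_rep (g (Suc r)) f z) / 2) = f" by simp
  with Suc show ?case by (simp add: syndrome_proj_def op_prod_simps)
qed

theorem mainTheorem3:
  fixes g :: "nat \<Rightarrow> 'n::{finite,linorder} pauli_string" and k :: nat
  assumes "k \<le> CARD('n)"
    and "stabilizer_generators (CARD('n) - k) g"
  shows "(\<forall>f\<in>H_phys. (\<lambda>z. \<Sum>s\<in>sign_vectors (CARD('n) - k).
            syndrome_proj (CARD('n) - k) g s f z) = f) \<and>
         (\<forall>s\<in>sign_vectors (CARD('n) - k). \<forall>s'\<in>sign_vectors (CARD('n) - k). \<forall>f\<in>H_phys.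
            syndrome_proj (CARD('n) - k) g s (syndrome_proj (CARD('n) - k) g s' f) =
              (if s = s' then syndrome_proj (CARD('n) - k) g s f else (\<lambda>z. 0))) \<and>
         (\<forall>f\<in>H_phys. syndrome_proj (CARD('n) - k) g (\<lambda>m\<in>{1..CARD('n) - k}. 1) f = f \<longleftrightarrow>
            f \<in> code_space (CARD('n) - k) g)"
proof -
  define r where "r = CARD('n) - k"
  define A where "A m = pauli_matrix (g m)" for m
  have comm: "A l ** A m = A m ** A l" if "l \<in> {1..r}" "m \<in> {1..r}" for l m
    using assms(2) that by (simp add: A_def r_def stabilizer_generators_def)
  have inv: "A m ** A m = mat 1" for m
    by (simp add: A_def pauli_matrix_square)
  have proj: "syndrome_proj r g s (tensor_fun c) = tensor_fun (joint_proj r A s c)" for s c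
    unfolding A_def by (rule syndrome_proj_tensor_fun)
  have sign: "s m \<in> {1, - 1}" if "s \<in> sign_vectors r" "m \<in> {1..r}" for s m
    using that unfolding sign_vectors_def by blast
  have "(\<lambda>z. \<Sum>s\<in>sign_vectors r. syndrome_proj r g s f z) = f" if "f \<in> H_phys" for f :: "'n modes \<Rightarrow> complex"
  proof -
    obtain c where "f = tensor_fun c" using H_phys_tensor_fun[OF \<open>f \<in> H_phys\<close>] .
    then show ?thesis
      by (simp add: proj sign_vectors_def joint_proj_sum del: One_nat_def flip: tensor_fun_sum)
  qed
  moreover have "syndrome_proj r g s (syndrome_proj r g s' f) =
      (if s = s' then syndrome_proj r g s f else (\<lambda>z. 0))"
    if "s \<in> sign_vectors r" "s' \<in> sign_vectors r" "f \<in> H_phys"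
    for s s' and f :: "'n modes \<Rightarrow> complex"
  proof -
    obtain c where "f = tensor_fun c" using H_phys_tensor_fun[OF \<open>f \<in> H_phys\<close>] .
    \<comment> \<open>Sign vectors are extensional, so agreement on \<open>{1..r}\<close> is
      equality.\<close>
    moreover have "(\<forall>m\<in>{1..r}. s m = s' m) \<longleftrightarrow> s = s'"
      using that(1,2) PiE_ext[of s "{1..r}" "\<lambda>_. {1, - 1}" s'] unfolding sign_vectors_def by blast
    ultimately show ?thesis
      using joint_proj_mult[OF comm inv sign[OF that(1)] sign[OF that(2)]]
      by (simp add: proj tensor_fun_0)
  qed
  moreover have "syndrome_proj r g (\<lambda>m\<in>{1..r}. 1) f = f \<longleftrightarrow> f \<in> code_space r g"
    if "f \<in> H_phys" for f :: "'n modes \<Rightarrow> complex"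
  proof
    assume fixed: "syndrome_proj r g (\<lambda>m\<in>{1..r}. 1) f = f"
    obtain c where c: "f = tensor_fun c" using H_phys_tensor_fun[OF \<open>f \<in> H_phys\<close>] .
    have "hol_rep (g m) f = f" if "m \<in> {1..r}" for m
    proof -
      \<comment> \<open>\<open>fixed\<close> rewrites the function \<open>f\<close> itself as the
        image of the projected vector; that \<open>c\<close> equals its projection would require
        injectivity of \<open>tensor_fun\<close>.\<close>
      have "hol_rep (g m) f = tensor_fun (A m *v joint_proj r A (\<lambda>m\<in>{1..r}. 1) c)"
        using fixed by (simp add: c proj A_def flip: hol_rep_tensor_fun)
      also have "A m *v joint_proj r A (\<lambda>m\<in>{1..r}. 1) c = joint_proj r A (\<lambda>m\<in>{1..r}. 1) c"
        using joint_proj_eigenvector[where s = "\<lambda>m\<in>{1..r}. 1", OF comm inv _ that] that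
        by (simp del: One_nat_def)
      finally show ?thesis using fixed by (simp add: c proj)
    qed
    with that show "f \<in> code_space r g" by (simp add: code_space_def)
  next
    assume "f \<in> code_space r g"
    then show "syndrome_proj r g (\<lambda>m\<in>{1..r}. 1) f = f"
      by (intro syndrome_proj_fixed) (auto simp: code_space_def)
  qed
  ultimately show ?thesis unfolding r_def by blast
qed

end
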